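(* Let $n$ be a positive integer, let $A=(a_{ij})$ be an $n\times n$ complex (Hermitian) positive semi-definite matrix, and let $\sigma$ be a permutation of $\{1,\dots,n\}$. If $\sigma$ is not the identity permutation, then $$\det(A)+\prod_{i=1}^n|a_{i,\sigma(i)}|\le \prod_{i=1}^na_{ii}.$$ Equality holds if either (i) $A$ is diagonal, or (ii) for each $i\in\{1,\dots,n\}$ at least one of the following holds: (a) $\sigma(i)=i$ and the vectors $Ae_i$, $e_i$ are collinear; (b) $\sigma(i)\ne i$ and $\sigma$ is a transposition; (c) $\sigma(i)\ne i$ and the vectors $Ae_i$, $Ae_{\sigma(i)}$ are collinear. If $A$ is positive definite, these conditions are also necessary for equality; that is, if $A$ is positive definite and equality holds, then (i) or (ii) holds.
   Context: $e_i$ denotes the $i$th column of the $n\times n$ identity matrix, so $Ae_i$ is the $i$th column of $A$. Two vectors $u,v\in\mathbb{C}^n$ are collinear if there are scalars $a,b$, not both zero, with $au=bv$. A transposition is a permutation that interchanges exactly two elements and fixes all others. *)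

theory Defs
  imports
    "Jordan_Normal_Form.Schur_Decomposition"
    "HOL-Combinatorics.Transposition"
begin

definition hermitian_mat :: "complex mat \<Rightarrow> bool" where
  "hermitian_mat A \<longleftrightarrow> square_mat A \<and> mat_adjoint A = A"

(* The inequalities below are in the order of HOL-Library.Complex_Order:
   0 \<le> z means that z is real and nonnegative, 0 < z that z is real and positive. *)

definition pos_semidef_mat :: "complex mat \<Rightarrow> bool" where
  "pos_semidef_mat A \<longleftrightarrow> hermitian_mat A \<and>
     (\<forall>v \<in> carrier_vec (dim_row A). 0 \<le> (A *\<^sub>v v) \<bullet>c v)"

definition pos_def_mat :: "complex mat \<Rightarrow> bool" where
  "pos_def_mat A \<longleftrightarrow> hermitian_mat A \<and>
     (\<forall>v \<in> carrier_vec (dim_row A). v \<noteq> 0\<^sub>v (dim_row A) \<longrightarrow> 0 < (A *\<^sub>v v) \<bullet>c v)"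

(* Linear dependence of u and v; unlike HOL-Analysis.collinear this is not about points on an
   affine line. *)

definition collinear_vecs :: "complex vec \<Rightarrow> complex vec \<Rightarrow> bool" where
  "collinear_vecs u v \<longleftrightarrow> (\<exists>a b. (a \<noteq> 0 \<or> b \<noteq> 0) \<and> a \<cdot>\<^sub>v u = b \<cdot>\<^sub>v v)"

definition is_transposition :: "('a \<Rightarrow> 'a) \<Rightarrow> bool" where
  "is_transposition p \<longleftrightarrow> (\<exists>a b. a \<noteq> b \<and> p = Transposition.transpose a b)"

end

theory Submission
  imports Defs
begin

text \<open>
  Eliminating row and column \<open>i\<close> by the congruence \<open>P A P\<^sup>*\<close> with \<open>det P = 1\<close> keeps the determinant and
  positive semi-definiteness and replaces \<open>a\<^sub>k\<^sub>k\<close> by \<open>a\<^sub>k\<^sub>k - |a\<^sub>i\<^sub>k|\<^sup>2 / a\<^sub>i\<^sub>i\<close>. Iterating gives Hadamard's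
  inequality with its equality case; eliminating one index \<open>i\<close> first gives
  \<open>det A \<le> (1 - r\<^sub>i) \<Prod>\<^sub>k a\<^sub>k\<^sub>k\<close> for \<open>r\<^sub>i = |a\<^sub>i\<^sub>j|\<^sup>2 / (a\<^sub>i\<^sub>i a\<^sub>j\<^sub>j)\<close> and \<open>j = \<sigma> i\<close>. Choose \<open>i\<close> among the non-fixed
  points of \<open>\<sigma>\<close> with \<open>r\<^sub>i\<close> maximal. The quotient \<open>\<Prod>\<^sub>k |a\<^sub>k\<^sub>\<sigma>\<^sub>k| / \<Prod>\<^sub>k a\<^sub>k\<^sub>k\<close> has square \<open>\<Prod>\<^sub>k r\<^sub>k\<close>;
  all factors are at most 1 and the two with \<open>k = i, j\<close> are at most \<open>r\<^sub>i\<close>, so the quotient is at most \<open>r\<^sub>i\<close>.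
  Equality with \<open>det A \<noteq> 0\<close> forces all off-diagonal entries outside \<open>{i, j}\<close> to vanish.
\<close>

section \<open>Hermitian symmetry and the quadratic form\<close>

lemma pos_semidef_matD:
  assumes A: "A \<in> carrier_mat n n" and psd: "pos_semidef_mat A"
  shows pos_semidef_mat_cnj: "\<And>i j. i < n \<Longrightarrow> j < n \<Longrightarrow> cnj (A $$ (i, j)) = A $$ (j, i)"
    and pos_semidef_mat_form: "\<And>v. v \<in> carrier_vec n \<Longrightarrow> 0 \<le> (A *\<^sub>v v) \<bullet>c v"
proof -
  show "cnj (A $$ (i, j)) = A $$ (j, i)" if "i < n" "j < n" for i j
  proof -
    have "mat_adjoint A $$ (j, i) = cnj (A $$ (i, j))"
      using that A unfolding mat_adjoint_def by (simp add: mat_of_rows_def)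
    thus ?thesis using psd by (simp add: pos_semidef_mat_def hermitian_mat_def)
  qed
  show "0 \<le> (A *\<^sub>v v) \<bullet>c v" if "v \<in> carrier_vec n" for v
    using psd that A by (auto simp: pos_semidef_mat_def)
qed

lemma pos_semidef_matI:
  assumes A: "A \<in> carrier_mat n n"
    and "\<And>i j. i < n \<Longrightarrow> j < n \<Longrightarrow> cnj (A $$ (i, j)) = A $$ (j, i)"
    and "\<And>v. v \<in> carrier_vec n \<Longrightarrow> 0 \<le> (A *\<^sub>v v) \<bullet>c v"
  shows "pos_semidef_mat A"
proof -
  have "mat_adjoint A = A"
    by (rule eq_matI) (use A assms(2) in \<open>auto simp: mat_adjoint_def mat_of_rows_def\<close>)
  thus ?thesis using A assms(3) by (auto simp: pos_semidef_mat_def hermitian_mat_def)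
qed

lemma pos_semidef_mat_diag:
  assumes A: "A \<in> carrier_mat n n" and psd: "pos_semidef_mat A" and i: "i < n"
  shows "A $$ (i, i) = of_real (Re (A $$ (i, i)))" and "0 \<le> Re (A $$ (i, i))"
proof -
  have "(A *\<^sub>v unit_vec n i) \<bullet>c unit_vec n i = (A *\<^sub>v unit_vec n i) \<bullet> unit_vec n i"
    by (rule arg_cong[of _ _ "scalar_prod _"], rule eq_vecI) (auto simp: unit_vec_def)
  also have "\<dots> = A $$ (i, i)"
    using A i by simp
  finally have "0 \<le> A $$ (i, i)"
    using pos_semidef_mat_form[OF A psd, of "unit_vec n i"] by simp
  thus "A $$ (i, i) = of_real (Re (A $$ (i, i)))" "0 \<le> Re (A $$ (i, i))"
    by (auto simp: less_eq_complex_def complex_eq_iff)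
qed

section \<open>Elimination of one index\<close>

text \<open>This is the Schur complement of the entry \<open>(i, i)\<close>, padded by a row and
  column that keep only that entry. The size and the indices stay the same, so diagonal products
  before and after can be compared factor by factor.\<close>

definition pivot :: "complex mat \<Rightarrow> nat \<Rightarrow> complex mat" where
  "pivot A i = mat (dim_row A) (dim_col A) (\<lambda>(k, l).
     if k = i \<or> l = i then (if k = l then A $$ (i, i) else 0)
     else A $$ (k, l) - A $$ (k, i) * A $$ (i, l) / A $$ (i, i))"

lemma pivot_carrier: "A \<in> carrier_mat n m \<Longrightarrow> pivot A i \<in> carrier_mat n m"
  by (simp add: pivot_def)

text \<open>The pivot is \<open>P * A * Q\<close>, where \<open>P\<close> subtracts multiples of row
  \<open>i\<close> from the other rows and \<open>Q\<close>, the conjugate transpose of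
  \<open>P\<close>, does the same to the columns. Both have determinant 1.\<close>

lemma
  assumes A: "A \<in> carrier_mat n n" and psd: "pos_semidef_mat A" and i: "i < n"
    and nz: "A $$ (i, i) \<noteq> 0"
  shows det_pivot: "det (pivot A i) = det A"
    and pos_semidef_pivot: "pos_semidef_mat (pivot A i)"
proof -
  define P where "P = mat n n (\<lambda>(k, l).
    if k = l then 1 else if l = i then - A $$ (k, i) / A $$ (i, i) else 0)"
  define Q where "Q = mat n n (\<lambda>(k, l).
    if k = l then 1 else if k = i then - A $$ (i, l) / A $$ (i, i) else 0)"
  have P: "P \<in> carrier_mat n n" and Q: "Q \<in> carrier_mat n n"
    by (auto simp: P_def Q_def)
  have B: "pivot A i \<in> carrier_mat n n" using A by (rule pivot_carrier)
  have PA: "(P * A) $$ (k, l) = (if k = i then A $$ (i, l)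
      else A $$ (k, l) - A $$ (k, i) / A $$ (i, i) * A $$ (i, l))"
    if kl: "k < n" "l < n" for k l
  proof -
    have "(P * A) $$ (k, l) = (\<Sum>m\<in>{0..<n}. P $$ (k, m) * A $$ (m, l))"
      using kl P A by (simp add: scalar_prod_def)
    \<comment> \<open>At most the terms \<open>m = k\<close> and \<open>m = i\<close> survive; the
      inner \<open>if\<close> keeps them from being counted twice when \<open>k = i\<close>.\<close>
    also have "\<dots> = (\<Sum>m\<in>{0..<n}. (if m = k then A $$ (k, l) else 0)
        + (if m = i then if k = i then 0 else - A $$ (k, i) / A $$ (i, i) * A $$ (i, l) else 0))"
      by (rule sum.cong) (use kl i in \<open>auto simp: P_def\<close>)
    also have "\<dots> = (if k = i then A $$ (i, l)
        else A $$ (k, l) - A $$ (k, i) / A $$ (i, i) * A $$ (i, l))"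
      using kl i by (simp add: sum.distrib)
    finally show ?thesis .
  qed
  have PAQ: "P * A * Q = pivot A i"
  proof (rule eq_matI)
    fix k l assume "k < dim_row (pivot A i)" "l < dim_col (pivot A i)"
    hence kl: "k < n" "l < n" using B by auto
    have "(P * A * Q) $$ (k, l) = (\<Sum>m\<in>{0..<n}. (P * A) $$ (k, m) * Q $$ (m, l))"
    proof -
      have "row (P * A) k $ m = (P * A) $$ (k, m)" if "m < n" for m
        using that kl P A by (intro index_row) auto
      thus ?thesis
        using kl P A Q by (subst index_mult_mat(1)) (auto simp: scalar_prod_def simp del: index_row)
    qed
    also have "\<dots> = (\<Sum>m\<in>{0..<n}. (if m = l then (P * A) $$ (k, l) else 0)
        + (if m = i then if l = i then 0 else - A $$ (i, l) / A $$ (i, i) * (P * A) $$ (k, i) else 0))"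
      by (rule sum.cong) (use kl i in \<open>auto simp: Q_def\<close>)
    also have "\<dots> = (P * A) $$ (k, l)
        + (if l = i then 0 else - A $$ (i, l) / A $$ (i, i) * (P * A) $$ (k, i))"
      using kl i by (simp add: sum.distrib)
    also have "\<dots> = pivot A i $$ (k, l)"
      using kl i A nz by (auto simp: PA pivot_def)
    finally show "(P * A * Q) $$ (k, l) = pivot A i $$ (k, l)" .
  qed (use P Q B in auto)
  \<comment> \<open>The pivot entry is real, which is what makes \<open>Q\<close> the conjugate
    transpose of \<open>P\<close>.\<close>
  have ii: "cnj (A $$ (i, i)) = A $$ (i, i)"
    using pos_semidef_mat_cnj[OF A psd i i] by simp
  have PQ: "P $$ (l, k) = cnj (Q $$ (k, l))" if "k < n" "l < n" for k l
    using that i ii pos_semidef_mat_cnj[OF A psd i, of l]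
    by (auto simp: P_def Q_def)
  have detP: "det P = 1"
  proof -
    \<comment> \<open>Row \<open>i\<close> of \<open>P\<close> is that of the identity, and so is
      what remains of \<open>P\<close> after deleting row and column \<open>i\<close>. For
      \<open>Q\<close> the same holds with column \<open>i\<close>.\<close>
    have "det P = (\<Sum>j<n. P $$ (i, j) * cofactor P i j)"
      by (rule laplace_expansion_row[OF P i])
    also have "\<dots> = (\<Sum>j<n. if j = i then cofactor P i i else 0)"
      by (rule sum.cong) (use i in \<open>auto simp: P_def\<close>)
    also have "\<dots> = cofactor P i i"
      using i by simp
    also have "mat_delete P i i = 1\<^sub>m (n - 1)"
      by (rule eq_matI) (use P i in \<open>auto simp: mat_delete_def P_def\<close>)
    hence "cofactor P i i = 1" by (simp add: cofactor_def)
    finally show ?thesis .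
  qed
  have detQ: "det Q = 1"
  proof -
    have "det Q = (\<Sum>j<n. Q $$ (j, i) * cofactor Q j i)"
      by (rule laplace_expansion_column[OF Q i])
    also have "\<dots> = (\<Sum>j<n. if j = i then cofactor Q i i else 0)"
      by (rule sum.cong) (use i in \<open>auto simp: Q_def\<close>)
    also have "\<dots> = cofactor Q i i"
      using i by simp
    also have "mat_delete Q i i = 1\<^sub>m (n - 1)"
      by (rule eq_matI) (use Q i in \<open>auto simp: mat_delete_def Q_def\<close>)
    hence "cofactor Q i i = 1" by (simp add: cofactor_def)
    finally show ?thesis .
  qed
  show "det (pivot A i) = det A"
    unfolding PAQ[symmetric] using P Q A detP detQ by (simp add: det_mult[of _ n])
  show "pos_semidef_mat (pivot A i)"
  proof (rule pos_semidef_matI[OF B])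
    fix k l assume "k < n" "l < n"
    thus "cnj (pivot A i $$ (k, l)) = pivot A i $$ (l, k)"
      using A i ii pos_semidef_mat_cnj[OF A psd, of k l] pos_semidef_mat_cnj[OF A psd, of i k]
        pos_semidef_mat_cnj[OF A psd, of k i]
        pos_semidef_mat_cnj[OF A psd, of i l]
      by (auto simp: pivot_def)
  next
    \<comment> \<open>Moving \<open>P\<close> across the inner product turns the form of
      \<open>P * A * Q\<close> at \<open>v\<close> into the form of \<open>A\<close> at
      \<open>Q *\<^sub>v v\<close>.\<close>
    fix v :: "complex vec" assume v: "v \<in> carrier_vec n"
    have "P\<^sup>T *\<^sub>v conjugate v = conjugate (Q *\<^sub>v v)"
      by (rule eq_vecI) (use P Q v PQ in \<open>auto simp: scalar_prod_def intro!: sum.cong\<close>)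
    moreover have "pivot A i *\<^sub>v v = P *\<^sub>v (A *\<^sub>v (Q *\<^sub>v v))"
    proof -
      have "P * A * Q *\<^sub>v v = P * A *\<^sub>v (Q *\<^sub>v v)"
        by (rule assoc_mult_mat_vec) (use P Q A v in auto)
      also have "\<dots> = P *\<^sub>v (A *\<^sub>v (Q *\<^sub>v v))"
        by (rule assoc_mult_mat_vec) (use P Q A v in auto)
      finally show ?thesis by (simp only: PAQ)
    qed
    moreover have "(P *\<^sub>v (A *\<^sub>v (Q *\<^sub>v v))) \<bullet>c v = (A *\<^sub>v (Q *\<^sub>v v)) \<bullet> (P\<^sup>T *\<^sub>v conjugate v)"
      using P Q A v transpose_vec_mult_scalar[of "P\<^sup>T" n n "conjugate v" "A *\<^sub>v (Q *\<^sub>v v)"]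
      by (simp add: comm_scalar_prod[of _ n])
    ultimately show "0 \<le> (pivot A i *\<^sub>v v) \<bullet>c v"
      using pos_semidef_mat_form[OF A psd, of "Q *\<^sub>v v"] Q v by simp
  qed
qed

section \<open>Diagonal entries: their decrease under elimination, and zeros\<close>

lemma pos_semidef_mat_cmod:
  assumes "A \<in> carrier_mat n n" "pos_semidef_mat A" "i < n" "j < n"
  shows "A $$ (i, j) * A $$ (j, i) = of_real ((cmod (A $$ (i, j)))\<^sup>2)"
    and "cmod (A $$ (j, i)) = cmod (A $$ (i, j))"
proof -
  have ji: "A $$ (j, i) = cnj (A $$ (i, j))"
    using pos_semidef_mat_cnj[OF assms] by simp
  show "A $$ (i, j) * A $$ (j, i) = of_real ((cmod (A $$ (i, j)))\<^sup>2)"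
    unfolding ji by (rule complex_norm_square[symmetric])
  show "cmod (A $$ (j, i)) = cmod (A $$ (i, j))"
    unfolding ji by simp
qed

text \<open>By Hermitian symmetry the subtracted term is a squared modulus over \<open>a_ii\<close>.
  Elimination thus never increases a diagonal entry, and leaves entry \<open>k\<close> unchanged
  only if \<open>a_ik = 0\<close> or \<open>k = i\<close>.\<close>

lemma pivot_diag:
  assumes A: "A \<in> carrier_mat n n" and psd: "pos_semidef_mat A" and i: "i < n" and k: "k < n"
  shows "Re (pivot A i $$ (k, k)) = Re (A $$ (k, k)) -
    (if k = i then 0 else (cmod (A $$ (i, k)))\<^sup>2 / Re (A $$ (i, i)))"
proof (cases "k = i")
  case False
  have "A $$ (k, i) * A $$ (i, k) / A $$ (i, i)
      = of_real ((cmod (A $$ (i, k)))\<^sup>2 / Re (A $$ (i, i)))"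
    using pos_semidef_mat_cmod[OF A psd i k]
    by (subst pos_semidef_mat_diag(1)[OF A psd i]) (simp add: mult.commute)
  thus ?thesis using A i k False by (simp add: pivot_def)
qed (use A i in \<open>simp add: pivot_def\<close>)

text \<open>With \<open>a_ii = 0\<close> the form at \<open>e_k + x e_i\<close> is
  \<open>a_kk + 2 Re (a_ki x)\<close>. It has no quadratic term in \<open>x\<close>, so it would be
  unbounded below if \<open>a_ki\<close> were nonzero.\<close>

lemma pos_semidef_mat_diag_zero:
  assumes A: "A \<in> carrier_mat n n" and psd: "pos_semidef_mat A" and i: "i < n" and k: "k < n"
    and z: "A $$ (i, i) = 0"
  shows "A $$ (i, k) = 0" "A $$ (k, i) = 0"
proof -
  show ki: "A $$ (k, i) = 0"
  proof (rule ccontr)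
    assume nz: "A $$ (k, i) \<noteq> 0"
    with z have ik: "i \<noteq> k" by auto
    define d where "d = Re (A $$ (k, k))"
    define c where "c = (cmod (A $$ (k, i)))\<^sup>2"
    \<comment> \<open>Chosen so that \<open>A $$ (k, i) * x = - (d + 1)\<close>. The two cross terms
      are conjugate, so the form at \<open>v\<close> is \<open>d - 2 * (d + 1) = - d - 2\<close>,
      which is negative.\<close>
    define x where "x = - of_real ((d + 1) / c) * cnj (A $$ (k, i))"
    define v where "v = vec n (\<lambda>l. if l = k then 1 else if l = i then x else 0)"
    have v: "v \<in> carrier_vec n" by (simp add: v_def)
    have c: "c > 0" using nz by (simp add: c_def)
    have Av: "(A *\<^sub>v v) $ p = A $$ (p, k) + A $$ (p, i) * x" if p: "p < n" for p
    proof -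
      have "(A *\<^sub>v v) $ p = (\<Sum>q\<in>{0..<n}. A $$ (p, q) * v $ q)"
        using A v p by (simp add: scalar_prod_def)
      also have "\<dots> = (\<Sum>q\<in>{0..<n}. (if q = k then A $$ (p, k) else 0)
          + (if q = i then A $$ (p, i) * x else 0))"
        by (rule sum.cong) (use ik in \<open>auto simp: v_def\<close>)
      finally show ?thesis using i k by (simp add: sum.distrib)
    qed
    have "(A *\<^sub>v v) \<bullet>c v = (\<Sum>p\<in>{0..<n}. (A *\<^sub>v v) $ p * cnj (v $ p))"
      using A v by (simp add: scalar_prod_def)
    also have "\<dots> = (\<Sum>p\<in>{0..<n}. (if p = k then (A *\<^sub>v v) $ k else 0)
        + (if p = i then (A *\<^sub>v v) $ i * cnj x else 0))"
      by (rule sum.cong) (use ik in \<open>auto simp: v_def\<close>)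
    also have "\<dots> = A $$ (k, k) + A $$ (k, i) * x + A $$ (i, k) * cnj x"
      using i k Av z by (simp add: sum.distrib)
    also have "A $$ (k, i) * x = - of_real (d + 1)"
    proof -
      have "A $$ (k, i) * x = - of_real ((d + 1) / c) * (A $$ (k, i) * cnj (A $$ (k, i)))"
        by (simp add: x_def)
      also have "\<dots> = - of_real ((d + 1) / c * c)"
        unfolding complex_norm_square[symmetric] c_def[symmetric] of_real_mult by simp
      finally show ?thesis using c by simp
    qed
    also have "A $$ (i, k) * cnj x = cnj (A $$ (k, i) * x)"
      using pos_semidef_mat_cnj[OF A psd k i] by simp
    also have "A $$ (k, i) * x = - of_real (d + 1)" by fact
    finally have "Re ((A *\<^sub>v v) \<bullet>c v) = - d - 2" by (simp add: d_def)
    moreover have "0 \<le> d" using pos_semidef_mat_diag(2)[OF A psd k] by (simp add: d_def)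
    ultimately show False
      using pos_semidef_mat_form[OF A psd v] by (simp add: less_eq_complex_def)
  qed
  show "A $$ (i, k) = 0" using pos_semidef_mat_cnj[OF A psd k i] ki by simp
qed

text \<open>All of row \<open>i\<close> vanishes. This settles the cases in which \<open>i\<close>
  cannot serve as a pivot.\<close>

lemma pos_semidef_mat_det_diag_zero:
  assumes A: "A \<in> carrier_mat n n" and psd: "pos_semidef_mat A" and i: "i < n"
    and z: "A $$ (i, i) = 0"
  shows "det A = 0"
  using pos_semidef_mat_diag_zero(1)[OF A psd i _ z]
  by (subst laplace_expansion_row[OF A i]) simp

section \<open>Hadamard's inequality and its equality case\<close>

lemma det_diagonal_mat:
  assumes "A \<in> carrier_mat n n" "diagonal_mat A"
  shows "det A = (\<Prod>i\<in>{0..<n}. A $$ (i, i))"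
  using assms det_upper_triangular[of A n]
  by (auto simp: diagonal_mat_def upper_triangular_def prod_list_diag_prod)

lemma prod_diag_of_real:
  assumes "A \<in> carrier_mat n n" "pos_semidef_mat A"
  shows "(\<Prod>i\<in>{0..<n}. A $$ (i, i)) = of_real (\<Prod>i\<in>{0..<n}. Re (A $$ (i, i)))"
  unfolding of_real_prod
  by (rule prod.cong) (use pos_semidef_mat_diag(1)[OF assms] in auto)

text \<open>A nonzero product forces all \<open>g l\<close> to be positive, so one strict factor
  would make the products strictly ordered. It turns equality of diagonal products into equality of
  diagonal entries.\<close>

lemma prod_mono_eqD:
  fixes f g :: "'a \<Rightarrow> real"
  assumes fin: "finite S" and le: "\<And>k. k \<in> S \<Longrightarrow> 0 \<le> f k \<and> f k \<le> g k"
    and eq: "prod f S = prod g S" and nz: "prod g S \<noteq> 0" and k: "k \<in> S"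
  shows "f k = g k"
proof (rule ccontr)
  assume "f k \<noteq> g k"
  hence lt: "f k < g k" using le[OF k] by simp
  have pos: "0 < g l" if "l \<in> S" for l
    using le[OF that] nz fin that by (metis less_eq_real_def order.trans prod_zero_iff)
  have "prod f S = f k * prod f (S - {k})" using fin k by (rule prod.remove)
  also have "\<dots> \<le> f k * prod g (S - {k})"
    by (rule mult_left_mono) (use le k in \<open>auto intro!: prod_mono\<close>)
  also have "\<dots> < g k * prod g (S - {k})"
    by (rule mult_strict_right_mono[OF lt]) (auto intro!: prod_pos pos)
  also have "\<dots> = prod g S" using fin k by (simp add: prod.remove)
  finally show False using eq by simp
qed

text \<open>\<open>F\<close> is the set of indices that have not been eliminated yet.\<close>
lemma hadamard_inequality_aux:
  assumes "finite F" "A \<in> carrier_mat n n" "pos_semidef_mat A"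
    and "\<And>k l. k < n \<Longrightarrow> l < n \<Longrightarrow> k \<noteq> l \<Longrightarrow> A $$ (k, l) \<noteq> 0 \<Longrightarrow> k \<in> F \<and> l \<in> F"
  shows "Im (det A) = 0 \<and> Re (det A) \<le> (\<Prod>k\<in>{0..<n}. Re (A $$ (k, k))) \<and>
    (det A \<noteq> 0 \<longrightarrow> Re (det A) = (\<Prod>k\<in>{0..<n}. Re (A $$ (k, k))) \<longrightarrow> diagonal_mat A)"
  using assms
proof (induction F arbitrary: A rule: finite_induct)
  case empty
  note A = empty(1,2)
  have "diagonal_mat A" using empty by (auto simp: diagonal_mat_def)
  thus ?case
    using det_diagonal_mat[OF A(1)] prod_diag_of_real[OF A] by (simp del: of_real_prod)
next
  case (insert i F)
  note A = insert.prems(1) and psd = insert.prems(2)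
  let ?d = "\<lambda>k. Re (A $$ (k, k))" and ?b = "\<lambda>k. Re (pivot A i $$ (k, k))"
  have d0: "0 \<le> ?d k" if "k < n" for k using pos_semidef_mat_diag(2)[OF A psd that] .
  consider "\<not> i < n" | "i < n" "A $$ (i, i) = 0" | "i < n" "A $$ (i, i) \<noteq> 0" by blast
  thus ?case
  proof cases
    case 1
    \<comment> \<open>An \<open>i\<close> outside the range is no index of \<open>A\<close>, so the
      hypothesis on off-diagonal entries already holds for \<open>F\<close>.\<close>
    show ?thesis
      by (rule insert.IH[OF A psd]) (use insert.prems(3) 1 in blast)
  next
    case 2
    \<comment> \<open>The determinant is zero here, so only this bound remains; the equality clause
      is void.\<close>
    have "0 \<le> (\<Prod>k\<in>{0..<n}. ?d k)" by (rule prod_nonneg) (use d0 in auto)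
    thus ?thesis using pos_semidef_mat_det_diag_zero[OF A psd 2] by simp
  next
    case 3
    note i = 3(1) and nz = 3(2)
    have di: "0 < ?d i"
      using d0[OF i] nz pos_semidef_mat_diag(1)[OF A psd i] by (cases "?d i = 0") auto
    have B: "pivot A i \<in> carrier_mat n n" and Bpsd: "pos_semidef_mat (pivot A i)"
      and detB: "det (pivot A i) = det A"
      using pivot_carrier[OF A] pos_semidef_pivot[OF A psd i nz] det_pivot[OF A psd i nz] by auto
    have b: "0 \<le> ?b k \<and> ?b k \<le> ?d k" if k: "k < n" for k
      using pos_semidef_mat_diag(2)[OF B Bpsd k] pivot_diag[OF A psd i k] di by simp
    have ih: "Im (det A) = 0 \<and> Re (det A) \<le> (\<Prod>k\<in>{0..<n}. ?b k) \<and>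
        (det A \<noteq> 0 \<longrightarrow> Re (det A) = (\<Prod>k\<in>{0..<n}. ?b k) \<longrightarrow> diagonal_mat (pivot A i))"
      unfolding detB[symmetric]
    proof (rule insert.IH[OF B Bpsd])
      fix k l assume kl: "k < n" "l < n" "k \<noteq> l" "pivot A i $$ (k, l) \<noteq> 0"
      \<comment> \<open>A nonzero off-diagonal entry of the pivot stems from \<open>a_kl\<close> or
        from \<open>a_ki a_il\<close>, so fill-in stays within \<open>insert i F\<close>, while row
        and column \<open>i\<close> are cleared.\<close>
      hence ne: "k \<noteq> i" "l \<noteq> i" and "A $$ (k, l) \<noteq> 0 \<or> A $$ (k, i) \<noteq> 0 \<and> A $$ (i, l) \<noteq> 0"
        using A by (auto simp: pivot_def split: if_splits)
      thus "k \<in> F \<and> l \<in> F"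
        using insert.prems(3)[of k l] insert.prems(3)[of k i] insert.prems(3)[of i l] kl i by auto
    qed
    have le: "(\<Prod>k\<in>{0..<n}. ?b k) \<le> (\<Prod>k\<in>{0..<n}. ?d k)"
      by (rule prod_mono) (use b in auto)
    have "diagonal_mat A" if det0: "det A \<noteq> 0" and eq: "Re (det A) = (\<Prod>k\<in>{0..<n}. ?d k)"
    proof -
      \<comment> \<open>Equality in the chain \<open>Re (det A) \<le> prod ?b \<le> prod ?d\<close>
        is used twice: the second link says that no diagonal entry decreased, so row
        \<open>i\<close> of \<open>A\<close> is zero off the diagonal; the first makes the pivot
        diagonal. The pivot then has the same off-diagonal entries as \<open>A\<close>.\<close>
      have eqb: "(\<Prod>k\<in>{0..<n}. ?b k) = (\<Prod>k\<in>{0..<n}. ?d k)" using ih le eq by linarith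
      have "(\<Prod>k\<in>{0..<n}. ?d k) \<noteq> 0" using eq det0 ih by (auto simp: complex_eq_iff)
      hence "?b k = ?d k" if "k < n" for k
        using prod_mono_eqD[OF _ _ eqb, of k] b that by auto
      hence ik: "A $$ (i, k) = 0" if "k < n" "k \<noteq> i" for k
        using pivot_diag[OF A psd i that(1)] di that by simp
      have ki: "A $$ (k, i) = 0" if "k < n" "k \<noteq> i" for k
        using ik[OF that] pos_semidef_mat_cnj[OF A psd i that(1)] by simp
      have "diagonal_mat (pivot A i)" using ih det0 eq eqb by simp
      hence kl: "pivot A i $$ (k, l) = 0" if "k < n" "l < n" "k \<noteq> l" for k l
        using that B by (simp add: diagonal_mat_def)
      have "A $$ (k, l) = 0" if "k < n" "l < n" "k \<noteq> l" for k l
        using kl[OF that] that A ik[of l] ki[of k] by (cases "k = i \<or> l = i") (auto simp: pivot_def)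
      thus ?thesis using A by (simp add: diagonal_mat_def)
    qed
    thus ?thesis using ih le by auto
  qed
qed

lemma
  assumes A: "A \<in> carrier_mat n n" and psd: "pos_semidef_mat A"
  shows pos_semidef_mat_Im_det: "Im (det A) = 0"
    and hadamard_inequality: "Re (det A) \<le> (\<Prod>k\<in>{0..<n}. Re (A $$ (k, k)))"
    and hadamard_equality_imp_diagonal: "det A \<noteq> 0 \<Longrightarrow>
      Re (det A) = (\<Prod>k\<in>{0..<n}. Re (A $$ (k, k))) \<Longrightarrow> diagonal_mat A"
  using hadamard_inequality_aux[OF _ A psd, of "{0..<n}"] by auto

section \<open>Fischer's inequality for a 2 by 2 block\<close>

text \<open>Eliminating \<open>i\<close> multiplies \<open>a_jj\<close> by the first factor of
  \<open>M\<close> and increases no other diagonal entry; Hadamard's inequality for the pivot does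
  the rest. The minor bound says that the new entry \<open>j\<close> is nonnegative.\<close>

lemma
  assumes A: "A \<in> carrier_mat n n" and psd: "pos_semidef_mat A"
    and i: "i < n" and j: "j < n" and ij: "i \<noteq> j"
    and nz: "A $$ (i, i) \<noteq> 0" "A $$ (j, j) \<noteq> 0"
  defines "M \<equiv> (1 - (cmod (A $$ (i, j)))\<^sup>2 / (Re (A $$ (i, i)) * Re (A $$ (j, j))))
      * (\<Prod>k\<in>{0..<n}. Re (A $$ (k, k)))"
  shows fischer_inequality: "Re (det A) \<le> M"
    and fischer_equality: "\<lbrakk>det A \<noteq> 0; Re (det A) = M; k < n; l < n; k \<noteq> l; {k, l} \<noteq> {i, j}\<rbrakk>
      \<Longrightarrow> A $$ (k, l) = 0"
    and pos_semidef_mat_minor: "(cmod (A $$ (i, j)))\<^sup>2 \<le> Re (A $$ (i, i)) * Re (A $$ (j, j))"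
proof -
  let ?d = "\<lambda>k. Re (A $$ (k, k))" and ?b = "\<lambda>k. Re (pivot A i $$ (k, k))"
  \<comment> \<open>An intermediate bound: the decrease is recorded at \<open>j\<close> only, so
    that the product of \<open>g\<close> is exactly \<open>M\<close>.\<close>
  define g where "g k = (if k = j then ?b j else ?d k)" for k
  have d: "?d k > 0" if "k = i \<or> k = j" for k
  proof -
    have "k < n" "A $$ (k, k) \<noteq> 0" using that i j nz by auto
    thus ?thesis using pos_semidef_mat_diag[OF A psd, of k] by (cases "?d k = 0") auto
  qed
  have B: "pivot A i \<in> carrier_mat n n" and Bpsd: "pos_semidef_mat (pivot A i)"
    and detB: "det (pivot A i) = det A"
    using pivot_carrier[OF A] pos_semidef_pivot[OF A psd i nz(1)] det_pivot[OF A psd i nz(1)] by auto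
  have b: "0 \<le> ?b k \<and> ?b k \<le> g k" if k: "k < n" for k
    using pos_semidef_mat_diag(2)[OF B Bpsd k] pivot_diag[OF A psd i k] d[of i]
    by (cases "k = j") (simp_all add: g_def)
  have bj: "?b j = ?d j - (cmod (A $$ (i, j)))\<^sup>2 / ?d i"
    using pivot_diag[OF A psd i j] ij by simp
  hence "(cmod (A $$ (i, j)))\<^sup>2 / ?d i \<le> ?d j" using b[OF j] by simp
  thus "(cmod (A $$ (i, j)))\<^sup>2 \<le> ?d i * ?d j" using d[of i] by (simp add: field_simps)
  have M: "(\<Prod>k\<in>{0..<n}. g k) = M"
  proof -
    have "(\<Prod>k\<in>{0..<n}. g k) = ?b j * (\<Prod>k\<in>{0..<n} - {j}. g k)"
      using j by (simp add: prod.remove[of _ j] g_def)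
    also have "(\<Prod>k\<in>{0..<n} - {j}. g k) = (\<Prod>k\<in>{0..<n} - {j}. ?d k)"
      by (rule prod.cong) (auto simp: g_def)
    also have "?b j = (1 - (cmod (A $$ (i, j)))\<^sup>2 / (?d i * ?d j)) * ?d j"
      using d[of i] d[of j] by (simp add: bj field_simps)
    also have "\<dots> * (\<Prod>k\<in>{0..<n} - {j}. ?d k) = M"
      using j by (simp add: M_def prod.remove[of _ j])
    finally show ?thesis .
  qed
  have le1: "Re (det A) \<le> (\<Prod>k\<in>{0..<n}. ?b k)"
    using hadamard_inequality[OF B Bpsd] detB by simp
  have le2: "(\<Prod>k\<in>{0..<n}. ?b k) \<le> M"
    unfolding M[symmetric] by (rule prod_mono) (use b in auto)
  show "Re (det A) \<le> M" using le1 le2 by simp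
  show "A $$ (k, l) = 0"
    if det0: "det A \<noteq> 0" and eq: "Re (det A) = M" and kl: "k < n" "l < n" "k \<noteq> l" "{k, l} \<noteq> {i, j}"
  proof -
    have eqb: "(\<Prod>k\<in>{0..<n}. ?b k) = (\<Prod>k\<in>{0..<n}. g k)" using le1 le2 eq M by linarith
    have "(\<Prod>k\<in>{0..<n}. g k) \<noteq> 0"
      using eq M det0 pos_semidef_mat_Im_det[OF A psd] by (auto simp: complex_eq_iff)
    hence "?b k = g k" if "k < n" for k
      using prod_mono_eqD[OF _ _ eqb, of k] b that by auto
    hence ik: "A $$ (i, k) = 0" if "k < n" "k \<noteq> i" "k \<noteq> j" for k
      using pivot_diag[OF A psd i that(1)] d[of i] that by (simp add: g_def)
    have ki: "A $$ (k, i) = 0" if "k < n" "k \<noteq> i" "k \<noteq> j" for k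
      using ik[OF that] pos_semidef_mat_cnj[OF A psd i that(1)] by simp
    have "diagonal_mat (pivot A i)"
      by (rule hadamard_equality_imp_diagonal[OF B Bpsd])
        (use det0 detB le1 le2 eq in auto)
    hence "pivot A i $$ (k, l) = 0" using kl B by (simp add: diagonal_mat_def)
    \<comment> \<open>Of two distinct indices other than \<open>i\<close>, at most one is
      \<open>j\<close>, so the correction \<open>a_ki a_il / a_ii\<close> vanishes and
      \<open>a_kl\<close> is the pivot's entry.\<close>
    thus ?thesis
      using kl A ik[of l] ki[of k] by (cases "k = i \<or> l = i") (auto simp: pivot_def)
  qed
qed

section \<open>Collinear columns and singularity\<close>

lemma collinear_vecs_index:
  assumes "collinear_vecs u v"
  obtains a b where "a \<noteq> 0 \<or> b \<noteq> 0"
    and "\<And>k. k < dim_vec u \<Longrightarrow> k < dim_vec v \<Longrightarrow> a * u $ k = b * v $ k"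
proof -
  obtain a b where ab: "a \<noteq> 0 \<or> b \<noteq> 0" and eq: "a \<cdot>\<^sub>v u = b \<cdot>\<^sub>v v"
    using assms by (auto simp: collinear_vecs_def)
  have "a * u $ k = b * v $ k" if "k < dim_vec u" "k < dim_vec v" for k
    using arg_cong[OF eq, of "\<lambda>w. w $ k"] that by simp
  with ab show thesis by (rule that)
qed

lemma mult_mat_unit_vec_index:
  fixes A :: "'a :: semiring_1 mat"
  assumes "A \<in> carrier_mat m n" "i < n" "k < m"
  shows "(A *\<^sub>v unit_vec n i) $ k = A $$ (k, i)"
  using assms by simp

lemma collinear_col_unit_vec_imp:
  assumes A: "A \<in> carrier_mat n n" and i: "i < n" and k: "k < n" "k \<noteq> i"
    and col: "collinear_vecs (A *\<^sub>v unit_vec n i) (unit_vec n i)"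
  shows "A $$ (k, i) = 0"
proof -
  obtain a b where ab: "a \<noteq> 0 \<or> b \<noteq> 0"
    and eq: "\<And>k. k < n \<Longrightarrow> a * A $$ (k, i) = b * unit_vec n i $ k"
    using collinear_vecs_index[OF col] A i mult_mat_unit_vec_index[OF A i]
    by (metis carrier_matD(1) dim_mult_mat_vec index_unit_vec(3))
  \<comment> \<open>With \<open>a = 0\<close>, entry \<open>i\<close> would give
    \<open>b = 0\<close> as well.\<close>
  have "a \<noteq> 0" using ab eq[OF i] i by auto
  thus ?thesis using eq[OF k(1)] i k by simp
qed

lemma collinear_col_unit_vecI:
  assumes A: "A \<in> carrier_mat n n" and i: "i < n"
    and "\<And>k. k < n \<Longrightarrow> k \<noteq> i \<Longrightarrow> A $$ (k, i) = 0"
  shows "collinear_vecs (A *\<^sub>v unit_vec n i) (unit_vec n i)"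
proof -
  have "1 \<cdot>\<^sub>v (A *\<^sub>v unit_vec n i) = A $$ (i, i) \<cdot>\<^sub>v unit_vec n i"
    by (rule eq_vecI) (use assms in auto)
  thus ?thesis unfolding collinear_vecs_def by (metis one_neq_zero)
qed

text \<open>A relation \<open>a A e_i = b A e_j\<close> puts the nonzero vector
  \<open>a e_i - b e_j\<close> into the kernel. Its entries \<open>i\<close> and \<open>j\<close>
  give the vanishing minor.\<close>

lemma
  assumes A: "A \<in> carrier_mat n n" and i: "i < n" and j: "j < n" and ij: "i \<noteq> j"
    and col: "collinear_vecs (A *\<^sub>v unit_vec n i) (A *\<^sub>v unit_vec n j)"
  shows collinear_cols_det: "det A = 0"
    and collinear_cols_minor: "A $$ (i, j) * A $$ (j, i) = A $$ (i, i) * A $$ (j, j)"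
proof -
  obtain a b where ab: "a \<noteq> 0 \<or> b \<noteq> 0"
    and eq: "\<And>k. k < n \<Longrightarrow> a * A $$ (k, i) = b * A $$ (k, j)"
    using collinear_vecs_index[OF col] A mult_mat_unit_vec_index[OF A i]
      mult_mat_unit_vec_index[OF A j] by (metis carrier_matD(1) dim_mult_mat_vec)
  define v where "v = vec n (\<lambda>l. if l = i then a else if l = j then - b else 0)"
  have v: "v \<in> carrier_vec n" by (simp add: v_def)
  have "A *\<^sub>v v = 0\<^sub>v n"
  proof (rule eq_vecI)
    fix p assume "p < dim_vec (0\<^sub>v n :: complex vec)"
    hence p: "p < n" by simp
    have "(A *\<^sub>v v) $ p = (\<Sum>q\<in>{0..<n}. A $$ (p, q) * v $ q)"
      using A v p by (simp add: scalar_prod_def)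
    also have "\<dots> = (\<Sum>q\<in>{0..<n}. (if q = i then A $$ (p, i) * a else 0)
        + (if q = j then - (A $$ (p, j) * b) else 0))"
      by (rule sum.cong) (use ij in \<open>auto simp: v_def\<close>)
    also have "\<dots> = a * A $$ (p, i) - b * A $$ (p, j)"
      using i j by (simp add: sum.distrib mult.commute)
    finally show "(A *\<^sub>v v) $ p = 0\<^sub>v n $ p" using eq[OF p] p by simp
  qed (use A in simp)
  moreover have "v \<noteq> 0\<^sub>v n"
  proof
    assume v0: "v = 0\<^sub>v n"
    have "v $ i = a" "v $ j = - b" using i j ij by (simp_all add: v_def)
    thus False using ab v0 i j by simp
  qed
  ultimately show "det A = 0" using v det_0_iff_vec_prod_zero[OF A] by blast
  \<comment> \<open>Only one of \<open>a\<close>, \<open>b\<close> is known to be nonzero, so the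
    identity is derived multiplied by each of them.\<close>
  have "a * (A $$ (i, i) * A $$ (j, j)) = b * A $$ (i, j) * A $$ (j, j)"
    using eq[OF i] by (simp add: mult.assoc[symmetric])
  also have "\<dots> = a * (A $$ (i, j) * A $$ (j, i))"
    using eq[OF j] by (simp add: algebra_simps)
  finally have 1: "a * (A $$ (i, i) * A $$ (j, j)) = a * (A $$ (i, j) * A $$ (j, i))" .
  have "b * (A $$ (i, i) * A $$ (j, j)) = a * A $$ (j, i) * A $$ (i, i)"
    using eq[OF j] by (simp add: algebra_simps)
  also have "\<dots> = b * (A $$ (i, j) * A $$ (j, i))"
    using eq[OF i] by (simp add: algebra_simps)
  finally have "b * (A $$ (i, i) * A $$ (j, j)) = b * (A $$ (i, j) * A $$ (j, i))" .
  thus "A $$ (i, j) * A $$ (j, i) = A $$ (i, i) * A $$ (j, j)" using ab 1 by auto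
qed

lemma pos_def_mat_det_nonzero:
  assumes A: "A \<in> carrier_mat n n" and pd: "pos_def_mat A"
  shows "det A \<noteq> 0"
proof
  assume "det A = 0"
  then obtain v where v: "v \<in> carrier_vec n" "v \<noteq> 0\<^sub>v n" and "A *\<^sub>v v = 0\<^sub>v n"
    using det_0_iff_vec_prod_zero[OF A] by blast
  hence "(A *\<^sub>v v) \<bullet>c v = 0" by simp
  moreover have "0 < (A *\<^sub>v v) \<bullet>c v" using pd v A by (auto simp: pos_def_mat_def)
  ultimately show False by simp
qed

section \<open>The product along \<sigma>\<close>

lemma prod_remove_two:
  assumes "finite S" "a \<in> S" "b \<in> S" "a \<noteq> b"
  shows "prod f S = f a * f b * prod f (S - {a, b})"
proof -
  have "prod f S = f a * prod f (S - {a})" using assms by (simp add: prod.remove)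
  also have "prod f (S - {a}) = f b * prod f (S - {a} - {b})"
    using assms by (intro prod.remove) auto
  also have "S - {a} - {b} = S - {a, b}" by auto
  finally show ?thesis by (simp add: mult.assoc)
qed

text \<open>By injectivity the image of a moved point is moved too, so two distinct factors are at
  most \<open>r i\<close>; the others are at most 1.\<close>

lemma prod_le_max_power2:
  fixes r :: "'a \<Rightarrow> real"
  assumes fin: "finite S" and r: "\<And>k. k \<in> S \<Longrightarrow> 0 \<le> r k \<and> r k \<le> 1"
    and perm: "\<sigma> permutes S" and i: "i \<in> S" "\<sigma> i \<noteq> i"
    and max: "\<And>k. k \<in> S \<Longrightarrow> \<sigma> k \<noteq> k \<Longrightarrow> r k \<le> r i"
  shows "prod r S \<le> (r i)\<^sup>2"
proof -
  have j: "\<sigma> i \<in> S" "\<sigma> (\<sigma> i) \<noteq> \<sigma> i"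
    using i perm permutes_in_image[OF perm] permutes_inj[OF perm] by (auto dest: injD)
  have "prod r S = r i * r (\<sigma> i) * prod r (S - {i, \<sigma> i})"
    using fin i j by (intro prod_remove_two) auto
  also have "\<dots> \<le> r i * r (\<sigma> i) * 1"
    by (rule mult_left_mono) (use r i j in \<open>auto intro!: prod_le_1\<close>)
  also have "\<dots> \<le> r i * r i * 1"
    using r[OF i(1)] max[OF j] by (auto intro!: mult_left_mono)
  finally show ?thesis by (simp add: power2_eq_square)
qed

text \<open>The two bounds share \<open>c\<close> and add up to \<open>D\<close>. Keeping them
  separate lets equality in the sum force equality in each.\<close>

lemma pos_semidef_mat_det_prod_bound:
  assumes A: "A \<in> carrier_mat n n" and psd: "pos_semidef_mat A"
    and perm: "\<sigma> permutes {0..<n}" and ne: "\<sigma> \<noteq> id"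
    and pos: "\<And>k. k < n \<Longrightarrow> A $$ (k, k) \<noteq> 0"
  defines "D \<equiv> \<Prod>k\<in>{0..<n}. Re (A $$ (k, k))"
  obtains i c where "i < n" "\<sigma> i \<noteq> i"
    and "c = (cmod (A $$ (i, \<sigma> i)))\<^sup>2 / (Re (A $$ (i, i)) * Re (A $$ (\<sigma> i, \<sigma> i)))"
    and "(\<Prod>k\<in>{0..<n}. cmod (A $$ (k, \<sigma> k))) \<le> c * D"
    and "Re (det A) \<le> (1 - c) * D"
proof -
  let ?d = "\<lambda>k. Re (A $$ (k, k))"
  \<comment> \<open>At a fixed point of \<sigma> this ratio is 1, so only the moved points matter in
    the choice of the maximum below.\<close>
  define r where "r k = (cmod (A $$ (k, \<sigma> k)))\<^sup>2 / (?d k * ?d (\<sigma> k))" for k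
  have d: "0 < ?d k" if "k < n" for k
    using pos[OF that] pos_semidef_mat_diag[OF A psd that] by (cases "?d k = 0") auto
  have s: "\<sigma> k < n" if "k < n" for k using permutes_in_image[OF perm, of k] that by simp
  have r01: "0 \<le> r k \<and> r k \<le> 1" if k: "k < n" for k
  proof (cases "\<sigma> k = k")
    case True
    have "A $$ (k, k) = of_real (?d k)" by (rule pos_semidef_mat_diag(1)[OF A psd k])
    hence "(cmod (A $$ (k, k)))\<^sup>2 = ?d k * ?d k"
      by (metis norm_of_real power2_abs power2_eq_square)
    thus ?thesis using True d[OF k] by (simp add: r_def)
  next
    case False
    thus ?thesis
      using pos_semidef_mat_minor[OF A psd k s[OF k] _ pos[OF k] pos[OF s[OF k]]]
        d[OF k] d[OF s[OF k]] by (simp add: r_def)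
  qed
  let ?N = "{k\<in>{0..<n}. \<sigma> k \<noteq> k}"
  have "?N \<noteq> {}" using ne perm by (auto simp: permutes_def fun_eq_iff)
  hence "Max (r ` ?N) \<in> r ` ?N" by (intro Max_in) auto
  then obtain i where i: "i < n" "\<sigma> i \<noteq> i" and "r i = Max (r ` ?N)" by auto
  hence max: "r k \<le> r i" if "k < n" "\<sigma> k \<noteq> k" for k using that by simp
  have D: "0 < D" unfolding D_def by (rule prod_pos) (use d in auto)
  let ?p = "\<Prod>k\<in>{0..<n}. cmod (A $$ (k, \<sigma> k))"
  \<comment> \<open>Squaring produces each diagonal entry once as \<open>?d k\<close> and once as
    \<open>?d (\<sigma> k)\<close>; reindexing by \<sigma> makes the second product \<open>D\<close>
    too.\<close>
  have "?p\<^sup>2 = (\<Prod>k\<in>{0..<n}. r k * (?d k * ?d (\<sigma> k)))"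
    unfolding prod_power_distrib
    by (rule prod.cong) (use d s in \<open>force simp: r_def\<close>)+
  also have "\<dots> = (\<Prod>k\<in>{0..<n}. r k) * (D * (\<Prod>k\<in>{0..<n}. ?d (\<sigma> k)))"
    by (simp add: prod.distrib D_def)
  also have "(\<Prod>k\<in>{0..<n}. ?d (\<sigma> k)) = D"
    unfolding D_def using prod.permute[OF perm, of ?d] by (simp add: comp_def)
  also have "(\<Prod>k\<in>{0..<n}. r k) * (D * D) \<le> (r i)\<^sup>2 * (D * D)"
    by (rule mult_right_mono[OF prod_le_max_power2[OF _ _ perm]])
      (use r01 i max in auto)
  also have "\<dots> = (r i * D)\<^sup>2" by (simp add: power2_eq_square)
  finally have "?p \<le> r i * D"
    using r01[OF i(1)] D by (auto intro: power2_le_imp_le)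
  moreover have "Re (det A) \<le> (1 - r i) * D"
    using fischer_inequality[OF A psd i(1) s[OF i(1)] _ pos[OF i(1)] pos[OF s[OF i(1)]]] i
    by (simp add: r_def D_def)
  ultimately show thesis using that[OF i refl] by (simp add: r_def)
qed

section \<open>Matrices with one off-diagonal pair\<close>

text \<open>Eliminating \<open>a\<close> leaves a diagonal matrix, so the determinant can be read
  off. With \<open>a_aa = 0\<close> every term is zero. This serves the case of a
  transposition.\<close>

lemma det_one_offdiag_pair:
  assumes A: "A \<in> carrier_mat n n" and psd: "pos_semidef_mat A"
    and a: "a < n" and b: "b < n" and ab: "a \<noteq> b"
    and off: "\<And>k l. k < n \<Longrightarrow> l < n \<Longrightarrow> k \<noteq> l \<Longrightarrow> {k, l} \<noteq> {a, b} \<Longrightarrow> A $$ (k, l) = 0"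
  shows "Re (det A) + (cmod (A $$ (a, b)))\<^sup>2 * (\<Prod>k\<in>{0..<n} - {a, b}. Re (A $$ (k, k)))
    = (\<Prod>k\<in>{0..<n}. Re (A $$ (k, k)))"
proof (cases "A $$ (a, a) = 0")
  case True
  thus ?thesis
    using pos_semidef_mat_diag_zero(1)[OF A psd a b] pos_semidef_mat_det_diag_zero[OF A psd a]
      a b ab by (simp add: prod_remove_two[of _ a b])
next
  case False
  let ?d = "\<lambda>k. Re (A $$ (k, k))" and ?b = "\<lambda>k. Re (pivot A a $$ (k, k))"
  have B: "pivot A a \<in> carrier_mat n n" and Bpsd: "pos_semidef_mat (pivot A a)"
    and detB: "det (pivot A a) = det A"
    using pivot_carrier[OF A] pos_semidef_pivot[OF A psd a False] det_pivot[OF A psd a False] by auto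
  have da: "?d a \<noteq> 0" using pos_semidef_mat_diag(1)[OF A psd a] False by auto
  \<comment> \<open>The correction \<open>a_ka a_al\<close> can be nonzero only for
    \<open>k = l = b\<close>, which is on the diagonal.\<close>
  have "pivot A a $$ (k, l) = 0" if kl: "k < n" "l < n" "k \<noteq> l" for k l
    using kl A a off[of k l] off[of k a] off[of a l]
    by (cases "k = b"; cases "l = b") (auto simp: pivot_def doubleton_eq_iff)
  hence "diagonal_mat (pivot A a)" using B by (simp add: diagonal_mat_def)
  hence "Re (det A) = (\<Prod>k\<in>{0..<n}. ?b k)"
    using det_diagonal_mat[OF B] prod_diag_of_real[OF B Bpsd] detB by (simp del: of_real_prod)
  also have "\<dots> = ?b a * ?b b * (\<Prod>k\<in>{0..<n} - {a, b}. ?b k)"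
    using a b ab by (intro prod_remove_two) auto
  also have "(\<Prod>k\<in>{0..<n} - {a, b}. ?b k) = (\<Prod>k\<in>{0..<n} - {a, b}. ?d k)"
    by (rule prod.cong[OF refl])
      (use pivot_diag[OF A psd a] off[OF a] in \<open>auto simp: doubleton_eq_iff\<close>)
  also have "?b a * ?b b = ?d a * ?d b - (cmod (A $$ (a, b)))\<^sup>2"
    using pivot_diag[OF A psd a a] pivot_diag[OF A psd a b] ab da by (simp add: field_simps)
  finally show ?thesis
    using a b ab by (simp add: prod_remove_two[of _ a b] algebra_simps)
qed

section \<open>The determinant inequality and its equality conditions\<close>

theorem corollary2p9:
  fixes n :: nat and A :: "complex mat" and \<sigma> :: "nat \<Rightarrow> nat"
  assumes "n > 0"
    and "A \<in> carrier_mat n n"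
    and "pos_semidef_mat A"
    and "\<sigma> permutes {0..<n}"
    and "\<sigma> \<noteq> id"
  defines "eq_holds \<equiv>
      det A + complex_of_real (\<Prod>i\<in>{0..<n}. cmod (A $$ (i, \<sigma> i))) = (\<Prod>i\<in>{0..<n}. A $$ (i, i))"
    and "cond \<equiv> diagonal_mat A \<or>
      (\<forall>i\<in>{0..<n}.
          (\<sigma> i = i \<and> collinear_vecs (A *\<^sub>v unit_vec n i) (unit_vec n i))
        \<or> (\<sigma> i \<noteq> i \<and> is_transposition \<sigma>)
        \<or> (\<sigma> i \<noteq> i \<and> collinear_vecs (A *\<^sub>v unit_vec n i) (A *\<^sub>v unit_vec n (\<sigma> i))))"
  shows "det A + complex_of_real (\<Prod>i\<in>{0..<n}. cmod (A $$ (i, \<sigma> i))) \<le> (\<Prod>i\<in>{0..<n}. A $$ (i, i))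
    \<and> (cond \<longrightarrow> eq_holds)
    \<and> (pos_def_mat A \<longrightarrow> eq_holds \<longrightarrow> cond)"
proof -
  note A = assms(2) and psd = assms(3) and perm = assms(4) and ne = assms(5)
  let ?d = "\<lambda>k. Re (A $$ (k, k))"
  define p where "p = (\<Prod>i\<in>{0..<n}. cmod (A $$ (i, \<sigma> i)))"
  define D where "D = (\<Prod>k\<in>{0..<n}. ?d k)"
  have prodD: "(\<Prod>i\<in>{0..<n}. A $$ (i, i)) = of_real D"
    using prod_diag_of_real[OF A psd] by (simp add: D_def)
  have detR: "det A = of_real (Re (det A))"
    using pos_semidef_mat_Im_det[OF A psd] by (simp add: complex_eq_iff)
  \<comment> \<open>All terms are real, so the complex equation amounts to one between real
    numbers.\<close>
  have eq_iff: "eq_holds \<longleftrightarrow> Re (det A) + p = D"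
    unfolding eq_holds_def prodD p_def[symmetric]
    using pos_semidef_mat_Im_det[OF A psd] by (auto simp: complex_eq_iff)
  have s: "\<sigma> k < n" if "k < n" for k using permutes_in_image[OF perm, of k] that by simp
  obtain m where m: "m < n" "\<sigma> m \<noteq> m"
  proof -
    obtain m where "\<sigma> m \<noteq> m" using ne by (auto simp: fun_eq_iff)
    thus thesis using that perm by (cases "m < n") (auto simp: permutes_def)
  qed
  \<comment> \<open>A zero diagonal entry makes row \<open>k\<close> vanish, and each of the three
    quantities with it. From here on the diagonal may be taken nonzero in the inequality.\<close>
  have zero: "det A = 0 \<and> p = 0 \<and> D = 0" if k: "k < n" "A $$ (k, k) = 0" for k
  proof -
    have "A $$ (k, \<sigma> k) = 0" using pos_semidef_mat_diag_zero(1)[OF A psd k(1) s[OF k(1)] k(2)] .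
    thus ?thesis
      using k pos_semidef_mat_det_diag_zero[OF A psd k] unfolding p_def D_def
      by (auto intro!: bexI[of _ k])
  qed
  have ineq: "Re (det A) + p \<le> D"
  proof (cases "\<exists>k<n. A $$ (k, k) = 0")
    case True
    thus ?thesis using zero by auto
  next
    case False
    obtain i c where "p \<le> c * D" "Re (det A) \<le> (1 - c) * D"
      using pos_semidef_mat_det_prod_bound[OF A psd perm ne] False unfolding p_def D_def by blast
    thus ?thesis by (simp add: algebra_simps)
  qed
  have suff: "Re (det A) + p = D" if cond
  proof -
    \<comment> \<open>Being a transposition is a property of \<sigma> as a whole: if it fails and
      \<open>A\<close> is not diagonal, every moved index must satisfy the collinearity condition
      (c).\<close>
    consider (diag) "diagonal_mat A" | (trans) "\<not> diagonal_mat A" "is_transposition \<sigma>"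
      | (col) "\<not> diagonal_mat A" "\<not> is_transposition \<sigma>" by blast
    thus ?thesis
    proof cases
      case diag
      have "A $$ (m, \<sigma> m) = 0" using diag m s[OF m(1)] A by (simp add: diagonal_mat_def)
      hence "p = 0" using m unfolding p_def by (auto intro!: bexI[of _ m])
      moreover have "Re (det A) = D" using det_diagonal_mat[OF A diag] prodD by simp
      ultimately show ?thesis by simp
    next
      case trans
      then obtain a b where ab: "a \<noteq> b" and sab: "\<sigma> = Transposition.transpose a b"
        by (auto simp: is_transposition_def)
      have an: "a < n" and bn: "b < n"
        using perm ab sab by (metis atLeastLessThan_iff permutes_def transpose_apply_first le0,
          metis atLeastLessThan_iff permutes_def transpose_apply_second le0)
      have fix0: "A $$ (k, l) = 0" if "k < n" "l < n" "k \<noteq> l" "l \<noteq> a" "l \<noteq> b" for k l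
      proof -
        \<comment> \<open>A fixed index can only satisfy alternative (a), so its column is zero off
          the diagonal.\<close>
        have "\<sigma> l = l" using that sab by simp
        hence "collinear_vecs (A *\<^sub>v unit_vec n l) (unit_vec n l)"
          using \<open>cond\<close> trans(1) that unfolding cond_def by auto
        thus ?thesis using collinear_col_unit_vec_imp[OF A] that by blast
      qed
      have off: "A $$ (k, l) = 0" if kl: "k < n" "l < n" "k \<noteq> l" "{k, l} \<noteq> {a, b}" for k l
      proof (cases "l = a \<or> l = b")
        case True
        hence "A $$ (l, k) = 0" using kl by (intro fix0) auto
        thus ?thesis using pos_semidef_mat_cnj[OF A psd kl(2) kl(1)] by simp
      qed (use fix0 kl in auto)
      have "p = cmod (A $$ (a, b)) * cmod (A $$ (b, a)) *
          (\<Prod>k\<in>{0..<n} - {a, b}. cmod (A $$ (k, \<sigma> k)))"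
        unfolding p_def using an bn ab by (subst prod_remove_two[of _ a b]) (simp_all add: sab)
      also have "(\<Prod>k\<in>{0..<n} - {a, b}. cmod (A $$ (k, \<sigma> k))) = (\<Prod>k\<in>{0..<n} - {a, b}. ?d k)"
      proof (rule prod.cong[OF refl])
        fix k assume k: "k \<in> {0..<n} - {a, b}"
        hence "\<sigma> k = k" by (simp add: sab)
        thus "cmod (A $$ (k, \<sigma> k)) = ?d k"
          using pos_semidef_mat_diag[OF A psd, of k] k
          by (metis DiffD1 abs_of_nonneg atLeastLessThan_iff norm_of_real)
      qed
      also have "cmod (A $$ (b, a)) = cmod (A $$ (a, b))"
        by (rule pos_semidef_mat_cmod(2)[OF A psd an bn])
      finally show ?thesis
        using det_one_offdiag_pair[OF A psd an bn ab off] by (simp add: D_def power2_eq_square)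
    next
      case col
      have colk: "collinear_vecs (A *\<^sub>v unit_vec n k) (A *\<^sub>v unit_vec n (\<sigma> k))"
        if "k < n" "\<sigma> k \<noteq> k" for k
        using \<open>cond\<close> col that unfolding cond_def by auto
      have det0: "det A = 0" using collinear_cols_det[OF A m(1) s[OF m(1)] _ colk[OF m]] m by simp
      \<comment> \<open>Collinear columns make the minor on \<open>k\<close> and
        \<open>\<sigma> k\<close> vanish; at a fixed point the identity is trivial. Together these
        give \<open>p = D\<close>, while the determinant is zero.\<close>
      have sq: "(cmod (A $$ (k, \<sigma> k)))\<^sup>2 = ?d k * ?d (\<sigma> k)" if k: "k < n" for k
      proof -
        have "A $$ (k, \<sigma> k) * A $$ (\<sigma> k, k) = A $$ (k, k) * A $$ (\<sigma> k, \<sigma> k)"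
          using collinear_cols_minor[OF A k s[OF k] _ colk[OF k]] by (cases "\<sigma> k = k") auto
        also have "\<dots> = of_real (?d k * ?d (\<sigma> k))"
          using pos_semidef_mat_diag(1)[OF A psd k] pos_semidef_mat_diag(1)[OF A psd s[OF k]] by simp
        finally show ?thesis
          using pos_semidef_mat_cmod(1)[OF A psd k s[OF k]] by (metis of_real_eq_iff)
      qed
      have "p\<^sup>2 = (\<Prod>k\<in>{0..<n}. ?d k * ?d (\<sigma> k))"
        unfolding p_def prod_power_distrib by (rule prod.cong) (use sq in auto)
      also have "\<dots> = D * (\<Prod>k\<in>{0..<n}. ?d (\<sigma> k))" by (simp add: prod.distrib D_def)
      also have "(\<Prod>k\<in>{0..<n}. ?d (\<sigma> k)) = D"
        unfolding D_def using prod.permute[OF perm, of ?d] by (simp add: comp_def)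
      finally have "p\<^sup>2 = D\<^sup>2" by (simp add: power2_eq_square)
      moreover have "0 \<le> p" unfolding p_def by (rule prod_nonneg) simp
      moreover have "0 \<le> D"
        unfolding D_def by (rule prod_nonneg) (use pos_semidef_mat_diag(2)[OF A psd] in auto)
      ultimately show ?thesis using det0 by (simp add: power2_eq_iff_nonneg)
    qed
  qed
  have nec: cond if pd: "pos_def_mat A" and eq: "Re (det A) + p = D"
  proof -
    have det0: "det A \<noteq> 0" by (rule pos_def_mat_det_nonzero[OF A pd])
    have pos: "A $$ (k, k) \<noteq> 0" if "k < n" for k using zero that det0 by auto
    obtain i c where i: "i < n" "\<sigma> i \<noteq> i"
      and c: "c = (cmod (A $$ (i, \<sigma> i)))\<^sup>2 / (?d i * ?d (\<sigma> i))"
      and bnd: "p \<le> c * D" "Re (det A) \<le> (1 - c) * D"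
      using pos_semidef_mat_det_prod_bound[OF A psd perm ne pos] unfolding p_def D_def by blast
    \<comment> \<open>The two bounds sum to \<open>D\<close>, and so do their left sides; hence both
      are tight.\<close>
    have eqs: "p = c * D" "Re (det A) = (1 - c) * D"
      using bnd eq by (simp_all add: algebra_simps)
    have off: "A $$ (k, l) = 0" if "k < n" "l < n" "k \<noteq> l" "{k, l} \<noteq> {i, \<sigma> i}" for k l
      using fischer_equality[OF A psd i(1) s[OF i(1)] _ pos[OF i(1)] pos[OF s[OF i(1)]] det0 _ that]
        i eqs(2) c by (simp add: D_def)
    show cond
    proof (cases "A $$ (i, \<sigma> i) = 0")
      case True
      hence "A $$ (\<sigma> i, i) = 0" using pos_semidef_mat_cnj[OF A psd i(1) s[OF i(1)]] by simp
      hence "A $$ (k, l) = 0" if "k < n" "l < n" "k \<noteq> l" for k l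
        using off[OF that] True by (auto simp: doubleton_eq_iff)
      hence "diagonal_mat A" using A by (simp add: diagonal_mat_def)
      thus ?thesis by (simp add: cond_def)
    next
      case False
      have "D \<noteq> 0" unfolding D_def
      proof (simp, intro ballI notI)
        fix k assume "k \<in> {0..<n}" "?d k = 0"
        thus False using pos[of k] pos_semidef_mat_diag(1)[OF A psd, of k] by simp
      qed
      moreover have "c \<noteq> 0"
        using False pos[OF i(1)] pos[OF s[OF i(1)]] pos_semidef_mat_diag(1)[OF A psd i(1)]
          pos_semidef_mat_diag(1)[OF A psd s[OF i(1)]] unfolding c
        by (metis divide_eq_0_iff mult_eq_0_iff norm_eq_zero of_real_0 power_not_zero)
      ultimately have "p \<noteq> 0" using eqs(1) by simp
      hence "A $$ (k, \<sigma> k) \<noteq> 0" if "k < n" for k using that by (auto simp: p_def)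
      \<comment> \<open>As \<open>p\<close> is nonzero, no \<open>A $$ (k, \<sigma> k)\<close>
        vanishes, whereas all off-diagonal entries outside the pair do. So \<sigma> moves only
        \<open>i\<close> and \<open>\<sigma> i\<close>, and is a transposition.\<close>
      hence moved: "{k, \<sigma> k} = {i, \<sigma> i}" if "k < n" "\<sigma> k \<noteq> k" for k
        using off[OF that(1) s[OF that(1)]] that by metis
      have "\<sigma> (\<sigma> i) \<noteq> \<sigma> i" using i(2) permutes_inj[OF perm] by (auto dest: injD)
      hence ssi: "\<sigma> (\<sigma> i) = i" using moved[OF s[OF i(1)]] by (auto simp: doubleton_eq_iff)
      have "\<sigma> k = Transposition.transpose i (\<sigma> i) k" for k
      proof (cases "\<sigma> k = k")
        case True
        hence "k \<noteq> i" "k \<noteq> \<sigma> i" using i(2) ssi by auto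
        thus ?thesis using True by simp
      next
        case False
        hence "k < n" using perm by (auto simp: permutes_def)
        hence "k = i \<or> k = \<sigma> i" using moved[OF _ False] by (auto simp: doubleton_eq_iff)
        thus ?thesis using ssi by auto
      qed
      hence "\<sigma> = Transposition.transpose i (\<sigma> i)" by (rule ext)
      hence tr: "is_transposition \<sigma>" using i(2) unfolding is_transposition_def by metis
      \<comment> \<open>A fixed \<open>k\<close> lies outside the pair, so \<open>off\<close> clears
        its column.\<close>
      have "collinear_vecs (A *\<^sub>v unit_vec n k) (unit_vec n k)" if k: "k < n" "\<sigma> k = k" for k
      proof (rule collinear_col_unit_vecI[OF A k(1)])
        fix l assume l: "l < n" "l \<noteq> k"
        have "k \<noteq> i" "k \<noteq> \<sigma> i" using k i(2) ssi by auto
        thus "A $$ (l, k) = 0" using off[OF l(1) k(1) l(2)] by (auto simp: doubleton_eq_iff)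
      qed
      thus ?thesis using tr unfolding cond_def by auto
    qed
  qed
  have "det A + complex_of_real p \<le> of_real D"
    using ineq by (subst detR) (simp add: less_eq_complex_def)
  thus ?thesis using suff nec eq_iff unfolding prodD p_def[symmetric] by blast
qed

end
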